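(* Let $p$ be a prime, let $a,b,z\in\mathbb Z$ with $z \ge 0$ and $p\nmid a$ and $a^z\equiv b\pmod p$, and let $k\in\mathbb N$. Then the algorithm DLL described below, run on input $(a,z,b,p,k)$, terminates and either outputs an integer $x\geq 0$ such that $a^x\equiv b\pmod{p^k}$, or outputs None; and it outputs None only if no integer $x\geq 0$ with $a^x\equiv b\pmod{p^k}$ exists.
   Context: Notation: for integers $u$ and $w>0$, $u \bmod w$ denotes the least non-negative residue of $u$ modulo $w$, and $\lfloor u/w\rfloor$ denotes floor division. $\nu_p$ denotes the $p$-adic valuation. Convention $0^0=1$. Algorithm DLL, on input integers $(a,z,b,p,k)$ with $p$ prime, $k\ge 0$, $z\ge 0$, executes the following steps with integer variables: 1. $m \leftarrow p^k$; $z\leftarrow z \bmod (p-1)$; $a\leftarrow a\bmod m$; $b\leftarrow b\bmod m$; $c\leftarrow a^z \bmod m$; $y\leftarrow 0$. 2. If $p=2$: $u\leftarrow 2$ and $e\leftarrow a^2\bmod m$. Otherwise: $u\leftarrow 1$ and $e\leftarrow a^{p-1}\bmod m$. 3. $h\leftarrow e-1$; $r\leftarrow 0$; while $p\mid h$ and $r<k$: $h\leftarrow h/p$, $r\leftarrow r+1$. (So $r=\min\{\nu_p(e-1),k\}$ and $h=(e-1)/p^r$.) Then $v\leftarrow p^r$. 4. If $v\nmid (b-c)$: if $p>2$ or $v\nmid (b-a)$, output None and stop; otherwise set $c\leftarrow a$ and $y\leftarrow 1$. 5. $g\leftarrow (hb)^{p-2}\bmod p$. 6. While $b\neq c$, repeat: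 (a) $d\leftarrow \big(g\cdot\lfloor (b-c)/v\rfloor\big)\bmod p$; $y\leftarrow y+d\,u$. (b) If $2r\ge k$: $f\leftarrow (1+(e-1)d)\bmod m$ and $e\leftarrow (1+(e-1)p)\bmod m$. Otherwise: $f\leftarrow e^d\bmod m$ and $e\leftarrow (f\cdot e^{p-d})\bmod m$. (c) $c\leftarrow (c f)\bmod m$; $u\leftarrow up$; $v\leftarrow vp$; $r\leftarrow r+1$. 7. Output $x=(p-1)y+z$. *)

theory Defs
  imports "HOL-Number_Theory.Number_Theory" "HOL-Library.While_Combinator"
begin

datatype dll_output = Output int | Output_None

text \<open>The loop of step 3, started with \<open>h = e - 1\<close> and \<open>r = 0\<close>; the state is \<open>(h, r)\<close>.
  The division is exact whenever it is executed.\<close>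

definition dll_valuation_loop :: "int \<Rightarrow> nat \<Rightarrow> int \<Rightarrow> (int \<times> nat) option" where
  "dll_valuation_loop p k e =
     while_option (\<lambda>(h, r). p dvd h \<and> r < k) (\<lambda>(h, r). (h div p, r + 1)) (e - 1, 0)"

record dll_state =
  st_c :: int
  st_y :: int
  st_e :: int
  st_u :: int
  st_v :: int
  st_r :: nat

text \<open>One pass through the body of the loop of step 6. Below, exponents are integers that are
  non-negative when evaluated (here \<open>0 \<le> d < p\<close>), so \<open>nat\<close> never truncates.\<close>

definition dll_main_body ::
    "int \<Rightarrow> nat \<Rightarrow> int \<Rightarrow> int \<Rightarrow> int \<Rightarrow> dll_state \<Rightarrow> dll_state" where
  "dll_main_body p k m b g s =
     (let c = st_c s; y = st_y s; e = st_e s; u = st_u s; v = st_v s; r = st_r s;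
          d = (g * ((b - c) div v)) mod p;
          y' = y + d * u;
          f = (if 2 * r \<ge> k then (1 + (e - 1) * d) mod m else e ^ nat d mod m);
          e' = (if 2 * r \<ge> k then (1 + (e - 1) * p) mod m else (f * e ^ nat (p - d)) mod m)
      in \<lparr> st_c = (c * f) mod m, st_y = y', st_e = e', st_u = u * p, st_v = v * p, st_r = r + 1 \<rparr>)"

definition dll_main_loop ::
    "int \<Rightarrow> nat \<Rightarrow> int \<Rightarrow> int \<Rightarrow> int \<Rightarrow> dll_state \<Rightarrow> dll_state option" where
  "dll_main_loop p k m b g = while_option (\<lambda>s. b \<noteq> st_c s) (dll_main_body p k m b g)"

text \<open>The run of the algorithm on input \<open>(a, z, b, p, k)\<close>: the value \<open>None\<close> of the option type means
  that the run does not terminate, \<open>Some out\<close> that it terminates with output \<open>out\<close>.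
  The algorithm's own answer None is \<open>Output_None\<close>.\<close>

definition DLL :: "int \<Rightarrow> int \<Rightarrow> int \<Rightarrow> int \<Rightarrow> nat \<Rightarrow> dll_output option" where
  "DLL a0 z0 b0 p k =
     (let m = p ^ k;
          z = z0 mod (p - 1);
          a = a0 mod m;
          b = b0 mod m;
          c0 = a ^ nat z mod m;
          u = (if p = 2 then 2 else 1);
          e = (if p = 2 then a ^ 2 mod m else a ^ nat (p - 1) mod m)
      in case dll_valuation_loop p k e of
           None \<Rightarrow> None
         | Some (h, r) \<Rightarrow>
             (let v = p ^ r in
              if \<not> v dvd (b - c0) \<and> (p > 2 \<or> \<not> v dvd (b - a)) then Some Output_None
              else
                (let c = (if v dvd (b - c0) then c0 else a);
                     y = (if v dvd (b - c0) then 0 else 1);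
                     g = (h * b) ^ nat (p - 2) mod p
                 in case dll_main_loop p k m b g
                           \<lparr> st_c = c, st_y = y, st_e = e, st_u = u, st_v = v, st_r = r \<rparr> of
                      None \<Rightarrow> None
                    | Some s \<Rightarrow> Some (Output ((p - 1) * st_y s + z)))))"

end

theory Submission imports Defs begin

text \<open>
  The main loop is Hensel lifting. It keeps \<open>c \<equiv> a\<^bsup>(p-1)y+z\<^esup>\<close> and \<open>e \<equiv> a\<^bsup>(p-1)u\<^esup>\<close> modulo \<open>p\<^bsup>k\<^esup>\<close>,
  with \<open>c \<equiv> b\<close> modulo \<open>p\<^bsup>r\<^esup>\<close> and \<open>e \<equiv> 1 + h p\<^bsup>r\<^esup>\<close> modulo \<open>p\<^bsup>r+1\<^esup>\<close> for the same \<open>h\<close> prime to \<open>p\<close>.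
  Multiplying \<open>c\<close> by \<open>e\<^bsup>d\<^esup> \<equiv> 1 + d h p\<^bsup>r\<^esup>\<close> corrects one more \<open>p\<close>-adic digit of \<open>c\<close>, and the inverse \<open>g\<close>
  of \<open>h b\<close> gives the digit \<open>d\<close>; raising \<open>e\<close> to the power \<open>p\<close> restores the invariant for \<open>r + 1\<close>.
  Once \<open>r = k\<close>, the residues \<open>b\<close> and \<open>c\<close> agree.

  The answer None is correct because powers of \<open>a\<close> that agree modulo an odd \<open>p\<close> already agree modulo
  \<open>p\<^bsup>r\<^esup>\<close>: their quotient \<open>w \<equiv> 1\<close> modulo \<open>p\<close> satisfies \<open>w\<^bsup>p-1\<^esup> \<equiv> 1\<close> modulo \<open>p\<^bsup>r\<^esup>\<close>, and the cofactor
  \<open>1 + w + \<dots> + w\<^bsup>p-2\<^esup> \<equiv> -1\<close> of \<open>w - 1\<close> is prime to \<open>p\<close>. For \<open>p = 2\<close> the powers of \<open>a\<close> modulo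
  \<open>2\<^bsup>r\<^esup>\<close> are just \<open>1\<close> and \<open>a\<close>.
\<close>

section \<open>Binomial expansions and the lifting of \<open>1 + h * p ^ r\<close> to the next power
  of \<open>p\<close>\<close>

lemma one_plus_power_cong_square:
  fixes x :: int
  shows "[(1 + x) ^ n = 1 + of_nat n * x] (mod x\<^sup>2)"
proof (induction n)
  case (Suc n)
  have "[(1 + x) ^ Suc n = (1 + x) * (1 + of_nat n * x)] (mod x\<^sup>2)"
    using cong_scalar_left[OF Suc] by simp
  also have "(1 + x) * (1 + of_nat n * x) = 1 + of_nat (Suc n) * x + x\<^sup>2 * of_nat n"
    by (simp add: algebra_simps power2_eq_square)
  also have "[1 + of_nat (Suc n) * x + x\<^sup>2 * of_nat n = 1 + of_nat (Suc n) * x] (mod x\<^sup>2)"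
    by (simp only: cong_iff_dvd_diff add_diff_cancel_left') simp
  finally show ?case .
qed simp

text \<open>Working modulo \<open>x ^ 3\<close> keeps the quadratic term in view: for odd
  \<open>p\<close> and \<open>r = 1\<close>, \<open>x\<^sup>2\<close> alone is not known to vanish
  modulo \<open>p ^ (r + 2)\<close>, only its product with \<open>p choose 2\<close>.\<close>

lemma one_plus_power_cong_cube:
  fixes x :: int
  shows "[(1 + x) ^ n = 1 + of_nat n * x + of_nat (n choose 2) * x\<^sup>2] (mod x ^ 3)"
proof (induction n)
  case (Suc n)
  have "[(1 + x) ^ Suc n = (1 + x) * (1 + of_nat n * x + of_nat (n choose 2) * x\<^sup>2)] (mod x ^ 3)"
    using cong_scalar_left[OF Suc] by simp
  also have "(1 + x) * (1 + of_nat n * x + of_nat (n choose 2) * x\<^sup>2) =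
      1 + of_nat (Suc n) * x + of_nat (Suc n choose 2) * x\<^sup>2 + x ^ 3 * of_nat (n choose 2)"
    by (simp add: algebra_simps power2_eq_square power3_eq_cube numeral_2_eq_2)
  also have "[1 + of_nat (Suc n) * x + of_nat (Suc n choose 2) * x\<^sup>2 + x ^ 3 * of_nat (n choose 2)
      = 1 + of_nat (Suc n) * x + of_nat (Suc n choose 2) * x\<^sup>2] (mod x ^ 3)"
    by (simp only: cong_iff_dvd_diff add_diff_cancel_left') simp
  finally show ?case .
qed (simp add: binomial_eq_0)

text \<open>Write \<open>e = 1 + x\<close> with \<open>p ^ r\<close> dividing \<open>x\<close>.
  Terms from the cubic on vanish because \<open>r + 2 \<le> 3 * r\<close>. The quadratic one
  vanishes because an odd \<open>p\<close> divides \<open>p choose 2\<close>, and for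
  \<open>p = 2\<close> because \<open>r + 2 \<le> 2 * r\<close>.\<close>

lemma prime_power_lift_cong:
  fixes p e h :: int
  assumes p: "prime p" and r: "1 \<le> r" "p = 2 \<longrightarrow> 2 \<le> r"
    and e: "[e = 1 + h * p ^ r] (mod p ^ (r + 1))"
  shows "[e ^ nat p = 1 + h * p ^ (r + 1)] (mod p ^ (r + 2))"
proof -
  have p0: "p > 1" using p by (simp add: prime_gt_1_int)
  obtain t where t: "e = 1 + h * p ^ r + p ^ (r + 1) * t"
    using e by (metis cong_iff_lin cong_sym)
  \<comment> \<open>\<open>h'\<close> absorbs the error term, making
    \<open>e = 1 + h' * p ^ r\<close> exact; it agrees with \<open>h\<close> modulo
    \<open>p\<close>.\<close>
  define h' where "h' = h + p * t"
  define x where "x = h' * p ^ r"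
  have ex: "e = 1 + x" by (simp add: t x_def h'_def algebra_simps)
  have bin: "[e ^ nat p = 1 + p * x + of_nat (nat p choose 2) * x\<^sup>2] (mod p ^ (r + 2))"
  proof (rule cong_dvd_modulus)
    show "[e ^ nat p = 1 + p * x + of_nat (nat p choose 2) * x\<^sup>2] (mod x ^ 3)"
      using one_plus_power_cong_cube[of x "nat p"] p0 ex by simp
    have "p ^ (r + 2) dvd p ^ (r * 3)" by (rule le_imp_power_dvd) (use r in simp)
    then show "p ^ (r + 2) dvd x ^ 3"
      by (simp add: x_def power_mult_distrib power_mult[symmetric] del: power_add)
  qed
  have "p ^ (r + 2) dvd of_nat (nat p choose 2) * x\<^sup>2"
  proof (cases "p = 2")
    case True
    have "p ^ (r + 2) dvd p ^ (r * 2)" by (rule le_imp_power_dvd) (use r True in simp)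
    then show ?thesis by (simp add: x_def power_mult_distrib power_mult[symmetric])
  next
    case False
    then have "nat p dvd (nat p choose 2)" using p p0 by (intro dvd_choose_prime) auto
    then have "int (nat p) dvd int (nat p choose 2)" by (simp only: int_dvd_int_iff)
    then have 1: "p dvd of_nat (nat p choose 2)" using p0 by simp
    have "p ^ (r + 1) dvd p ^ (r * 2)" by (rule le_imp_power_dvd) (use r in simp)
    then have "p ^ (r + 1) dvd x\<^sup>2"
      by (simp add: x_def power_mult_distrib power_mult[symmetric])
    from mult_dvd_mono[OF 1 this] show ?thesis by simp
  qed
  then have "[1 + p * x + of_nat (nat p choose 2) * x\<^sup>2 = 1 + p * x] (mod p ^ (r + 2))"
    by (simp add: cong_iff_dvd_diff)
  moreover have "1 + p * x = 1 + h * p ^ (r + 1) + p ^ (r + 2) * t"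
    by (simp add: x_def h'_def algebra_simps power2_eq_square)
  then have "[1 + p * x = 1 + h * p ^ (r + 1)] (mod p ^ (r + 2))"
    by (simp add: cong_iff_dvd_diff)
  ultimately show ?thesis using bin cong_trans by blast
qed

section \<open>Powers of \<open>a\<close> modulo \<open>p\<close> and modulo
  \<open>p ^ r\<close>\<close>

lemma cong_1_of_power_prime_minus_1:
  fixes p w :: int
  assumes p: "prime p" and w: "[w = 1] (mod p)" "[w ^ nat (p - 1) = 1] (mod p ^ r)"
  shows "[w = 1] (mod p ^ r)"
proof -
  have p0: "p > 1" using p by (simp add: prime_gt_1_int)
  have "[(\<Sum>i<nat (p - 1). w ^ i) = (\<Sum>i<nat (p - 1). 1 ^ i)] (mod p)"
    by (intro cong_sum cong_pow w)
  then have "[(\<Sum>i<nat (p - 1). w ^ i) = p - 1] (mod p)" using p0 by simp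
  moreover have "coprime (p - 1) p" by (metis coprime_diff_one_left)
  ultimately have "coprime (\<Sum>i<nat (p - 1). w ^ i) p"
    by (meson cong_imp_coprime cong_sym)
  then have cop: "coprime (p ^ r) (\<Sum>i<nat (p - 1). w ^ i)"
    by (simp add: coprime_commute)
  have "p ^ r dvd w ^ nat (p - 1) - 1" using w(2) by (simp add: cong_iff_dvd_diff)
  then have "p ^ r dvd (w - 1) * (\<Sum>i<nat (p - 1). w ^ i)" by (simp add: power_diff_1_eq)
  then show ?thesis using cop by (simp add: cong_iff_dvd_diff coprime_dvd_mult_left_iff)
qed

lemma fermat_theorem_int:
  fixes p a :: int
  assumes p: "prime p" and a: "\<not> p dvd a"
  shows "[a ^ nat (p - 1) = 1] (mod p)"
proof -
  have p0: "p > 1" using p by (simp add: prime_gt_1_int)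
  have mod0: "a mod p \<ge> 0" using p0 by simp
  have "\<not> nat p dvd nat (a mod p)"
    using a p0 mod0 by (simp add: nat_dvd_iff dvd_mod_iff)
  then have "[nat (a mod p) ^ (nat p - 1) = 1] (mod nat p)"
    using p by (intro fermat_theorem) auto
  then have "[int (nat (a mod p) ^ (nat p - 1)) = int 1] (mod int (nat p))"
    by (simp only: cong_int_iff)
  then have "[(a mod p) ^ nat (p - 1) = 1] (mod p)"
    using p0 mod0 by (simp add: nat_diff_distrib)
  then show ?thesis by (metis cong_mod_left cong_pow cong_refl cong_sym cong_trans)
qed

lemma power_cong_power_mod_prime_minus_1:
  fixes p a x :: int
  assumes p: "prime p" and a: "\<not> p dvd a" and x: "x \<ge> 0"
  shows "[a ^ nat x = a ^ nat (x mod (p - 1))] (mod p)"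
proof -
  have p0: "p > 1" using p by (simp add: prime_gt_1_int)
  have q0: "x div (p - 1) \<ge> 0" "x mod (p - 1) \<ge> 0"
    using p0 x by (auto simp: pos_imp_zdiv_nonneg_iff)
  have "nat x = nat ((p - 1) * (x div (p - 1)) + x mod (p - 1))" by simp
  also have "\<dots> = nat (p - 1) * nat (x div (p - 1)) + nat (x mod (p - 1))"
    using p0 q0 by (subst nat_add_distrib) (auto simp: nat_mult_distrib)
  finally have "a ^ nat x = (a ^ nat (p - 1)) ^ nat (x div (p - 1)) * a ^ nat (x mod (p - 1))"
    by (simp add: power_add power_mult)
  also have "[\<dots> = 1 ^ nat (x div (p - 1)) * a ^ nat (x mod (p - 1))] (mod p)"
    by (intro cong_mult cong_pow fermat_theorem_int p a cong_refl)
  finally show ?thesis by simp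
qed

lemma power_cong_prime_imp_prime_power:
  fixes p a :: int
  assumes p: "prime p" and a: "\<not> p dvd a" and ar: "[a ^ nat (p - 1) = 1] (mod p ^ r)"
    and xy: "[a ^ x = a ^ y] (mod p)"
  shows "[a ^ x = a ^ y] (mod p ^ r)"
  using xy
proof (induction x y rule: linorder_wlog)
  case (le x y)
  \<comment> \<open>With \<open>x \<le> y\<close> the quotient of the two powers is
    \<open>a ^ (y - x)\<close>, so no modular inverse is needed.\<close>
  have ay: "a ^ y = a ^ x * a ^ (y - x)" using le by (simp flip: power_add)
  have "coprime p a" using p a by (rule prime_imp_coprime)
  then have "coprime (a ^ x) p" by (simp add: coprime_commute)
  moreover have "[a ^ x * a ^ (y - x) = a ^ x * 1] (mod p)"
    using le(2) ay by (simp add: cong_sym_eq)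
  ultimately have "[a ^ (y - x) = 1] (mod p)" by (simp only: cong_mult_lcancel)
  moreover have "[(a ^ (y - x)) ^ nat (p - 1) = 1] (mod p ^ r)"
    using cong_pow[OF ar, of "y - x"] by (simp add: power_mult[symmetric] mult.commute)
  ultimately have "[a ^ (y - x) = 1] (mod p ^ r)"
    using p by (rule cong_1_of_power_prime_minus_1[rotated])
  from cong_scalar_left[OF this, of "a ^ x"] show ?case by (simp add: ay cong_sym_eq)
next
  case (sym x y)
  then show ?case by (simp add: cong_sym_eq)
qed

section \<open>Termination and invariants of the two loops\<close>

lemma measure_while_option_invariant:
  fixes f :: "'s \<Rightarrow> nat"
  assumes "\<And>s. P s \<Longrightarrow> b s \<Longrightarrow> P (c s) \<and> f (c s) < f s" and "P s"
  obtains t where "while_option b c s = Some t" "P t" "\<not> b t"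
proof -
  obtain t where t: "while_option b c s = Some t"
    using measure_while_option_Some[of P b c f s] assms by blast
  moreover have "P t" using while_option_rule[OF _ t, of P] assms by blast
  ultimately show thesis using that while_option_stop[OF t] by blast
qed

text \<open>\<open>k - r\<close> decreases, so the loop stops even when \<open>e = 1\<close> and
  \<open>h\<close> stays zero. Only a stop before \<open>r = k\<close> shows that \<open>p\<close>
  does not divide \<open>h\<close>.\<close>

lemma dll_valuation_loop_result:
  assumes "p > 1"
  obtains h r where "dll_valuation_loop p k e = Some (h, r)" "h * p ^ r = e - 1" "r \<le> k"
    "r < k \<longrightarrow> \<not> p dvd h"
proof -
  let ?P = "\<lambda>(h, r). h * p ^ r = e - 1 \<and> r \<le> k"
  obtain t where "while_option (\<lambda>(h, r). p dvd h \<and> r < k) (\<lambda>(h, r). (h div p, r + 1)) (e - 1, 0)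
      = Some t" "?P t" "\<not> (\<lambda>(h, r). p dvd h \<and> r < k) t"
    by (rule measure_while_option_invariant[where f = "\<lambda>(h, r). k - r" and P = ?P
        and b = "\<lambda>(h, r). p dvd h \<and> r < k" and c = "\<lambda>(h, r). (h div p, r + 1)" and s = "(e - 1, 0)"])
      (auto simp flip: mult.assoc)
  then show thesis using that unfolding dll_valuation_loop_def by auto
qed

text \<open>The condition \<open>2 \<le> r\<close> for \<open>p = 2\<close> is what makes squaring \<open>e = 1 + h 2\<^bsup>r\<^esup>\<close> raise \<open>r\<close> by exactly one.
  The last conjunct is guarded by \<open>r < k\<close> because \<open>h\<close> may be divisible by \<open>p\<close> (even zero) otherwise.\<close>

definition dll_invariant ::
    "int \<Rightarrow> int \<Rightarrow> int \<Rightarrow> int \<Rightarrow> nat \<Rightarrow> int \<Rightarrow> int \<Rightarrow> dll_state \<Rightarrow> bool" where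
  "dll_invariant a z b p k h g s \<longleftrightarrow>
     0 \<le> st_c s \<and> st_c s < p ^ k \<and> 0 \<le> st_y s \<and> 0 \<le> st_u s \<and>
     [st_c s = a ^ nat ((p - 1) * st_y s + z)] (mod p ^ k) \<and>
     [st_e s = a ^ nat ((p - 1) * st_u s)] (mod p ^ k) \<and>
     st_v s = p ^ st_r s \<and> st_v s dvd b - st_c s \<and> st_r s \<le> k \<and>
     (st_r s < k \<longrightarrow> 1 \<le> st_r s \<and> (p = 2 \<longrightarrow> 2 \<le> st_r s) \<and> [g * (h * b) = 1] (mod p) \<and>
        [st_e s = 1 + h * p ^ st_r s] (mod p ^ (st_r s + 1)))"

lemma dll_invariant_main_body:
  assumes p: "prime p" and z: "0 \<le> z" and b: "0 \<le> b" "b < p ^ k"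
    and inv: "dll_invariant a z b p k h g s" and ne: "b \<noteq> st_c s"
  shows "dll_invariant a z b p k h g (dll_main_body p k (p ^ k) b g s)
    \<and> k - st_r (dll_main_body p k (p ^ k) b g s) < k - st_r s"
proof -
  obtain c y e u v r where s: "s = \<lparr>st_c = c, st_y = y, st_e = e, st_u = u, st_v = v, st_r = r\<rparr>"
    by (cases s) auto
  have p0: "p > 1" using p by (simp add: prime_gt_1_int)
  have i: "0 \<le> c" "c < p ^ k" "0 \<le> y" "0 \<le> u"
     "[c = a ^ nat ((p - 1) * y + z)] (mod p ^ k)"
     "[e = a ^ nat ((p - 1) * u)] (mod p ^ k)"
     "v = p ^ r" "v dvd b - c" "r \<le> k"
    using inv by (auto simp: dll_invariant_def s)
  \<comment> \<open>At \<open>r = k\<close> the residues \<open>b\<close> and \<open>c\<close>, both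
    reduced modulo \<open>p ^ k\<close>, would be equal.\<close>
  have "r \<noteq> k"
  proof
    assume "r = k"
    then have "[b = c] (mod p ^ k)" using i by (simp add: cong_iff_dvd_diff)
    then show False using b i ne s by (simp add: cong_less_imp_eq_int)
  qed
  then have rk: "r < k" using i by simp
  then have j: "1 \<le> r" "p = 2 \<longrightarrow> 2 \<le> r" "[g * (h * b) = 1] (mod p)"
      and e1: "[e = 1 + h * p ^ r] (mod p ^ (r + 1))"
    using inv by (auto simp: dll_invariant_def s)
  define d where "d = (g * ((b - c) div v)) mod p"
  have d: "0 \<le> d" "d < p" using p0 by (auto simp: d_def)
  define f where "f = (if 2 * r \<ge> k then (1 + (e - 1) * d) mod p ^ k else e ^ nat d mod p ^ k)"
  define e' where "e' = (if 2 * r \<ge> k then (1 + (e - 1) * p) mod p ^ k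
    else (f * e ^ nat (p - d)) mod p ^ k)"
  have body: "dll_main_body p k (p ^ k) b g s = \<lparr>st_c = (c * f) mod p ^ k, st_y = y + d * u,
      st_e = e', st_u = u * p, st_v = v * p, st_r = r + 1\<rparr>"
    by (simp add: dll_main_body_def s Let_def d_def f_def e'_def)
  have pre: "p ^ r dvd e - 1"
  proof -
    have "[e = 1 + h * p ^ r] (mod p ^ r)"
      using e1 by (rule cong_dvd_modulus) (simp add: le_imp_power_dvd)
    then have "p ^ r dvd e - (1 + h * p ^ r)" by (simp add: cong_iff_dvd_diff)
    then have "p ^ r dvd e - (1 + h * p ^ r) + h * p ^ r" by (rule dvd_add) simp
    then show ?thesis by (simp add: algebra_simps)
  qed
  \<comment> \<open>Used with \<open>l = k\<close> to justify the linear formulas of the branch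
    \<open>2 * r \<ge> k\<close>, and with \<open>l = r + 1\<close> in either branch to compute the
    next digit.\<close>
  have sq: "[e ^ n = 1 + (e - 1) * of_nat n] (mod p ^ l)" if "l \<le> 2 * r" for n l
  proof (rule cong_dvd_modulus)
    show "[e ^ n = 1 + (e - 1) * of_nat n] (mod (e - 1)\<^sup>2)"
      using one_plus_power_cong_square[of "e - 1" n] by (simp add: mult.commute)
    have "p ^ l dvd p ^ (2 * r)" using that by (rule le_imp_power_dvd)
    also have "\<dots> = (p ^ r)\<^sup>2" by (simp add: power_mult[symmetric] mult.commute)
    also have "\<dots> dvd (e - 1)\<^sup>2" using pre by (rule dvd_power_same)
    finally show "p ^ l dvd (e - 1)\<^sup>2" .
  qed
  have f: "[f = e ^ nat d] (mod p ^ k)"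
    using sq[of k "nat d"] d by (auto simp: f_def cong_sym_eq)
  have e': "[e' = e ^ nat p] (mod p ^ k)"
  proof (cases "2 * r \<ge> k")
    case True
    then show ?thesis using sq[of k "nat p"] p0 by (auto simp: e'_def cong_sym_eq)
  next
    case False
    have "[f * e ^ nat (p - d) = e ^ nat d * e ^ nat (p - d)] (mod p ^ k)"
      using f by (rule cong_scalar_right)
    moreover have "e ^ nat d * e ^ nat (p - d) = e ^ nat p"
      using d by (simp flip: power_add nat_add_distrib)
    ultimately show ?thesis using False by (simp add: e'_def)
  qed
  have c': "[c * f = a ^ nat ((p - 1) * (y + d * u) + z)] (mod p ^ k)"
  proof -
    have "[c * f = a ^ nat ((p - 1) * y + z) * (a ^ nat ((p - 1) * u)) ^ nat d] (mod p ^ k)"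
      by (intro cong_mult i cong_trans[OF f] cong_pow)
    also have "a ^ nat ((p - 1) * y + z) * (a ^ nat ((p - 1) * u)) ^ nat d
        = a ^ (nat ((p - 1) * y + z) + nat ((p - 1) * u) * nat d)"
      by (simp add: power_add power_mult)
    also have "nat ((p - 1) * y + z) + nat ((p - 1) * u) * nat d
        = nat ((p - 1) * (y + d * u) + z)"
    proof -
      have "0 \<le> (p - 1) * y + z" "0 \<le> (p - 1) * u" using p0 i z by auto
      then have "nat (((p - 1) * y + z) + (p - 1) * u * d)
          = nat ((p - 1) * y + z) + nat ((p - 1) * u) * nat d"
        using d by (simp add: nat_add_distrib nat_mult_distrib)
      then show ?thesis by (simp add: algebra_simps)
    qed
    finally show ?thesis .
  qed
  have e'': "[e' = a ^ nat ((p - 1) * (u * p))] (mod p ^ k)"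
  proof -
    have "[e' = (a ^ nat ((p - 1) * u)) ^ nat p] (mod p ^ k)"
      by (intro cong_trans[OF e'] cong_pow i)
    also have "(a ^ nat ((p - 1) * u)) ^ nat p = a ^ nat ((p - 1) * (u * p))"
      using p0 i by (simp add: power_mult[symmetric] nat_mult_distrib[symmetric] mult.assoc)
    finally show ?thesis .
  qed
  \<comment> \<open>With \<open>b - c = t * p ^ r\<close>, the new error is
    \<open>p ^ r * (t - c * d * h)\<close> modulo \<open>p ^ (r + 1)\<close>. Since \<open>c\<close>
    is \<open>b\<close> modulo \<open>p\<close> and \<open>d\<close> is \<open>g * t\<close>, where
    \<open>g\<close> inverts \<open>h * b\<close>, the bracket vanishes modulo
    \<open>p\<close>.\<close>
  have dvd: "p ^ (r + 1) dvd b - c * f"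
  proof -
    define t where "t = (b - c) div v"
    have t: "b - c = t * p ^ r" using i by (simp add: t_def)
    have "[f = 1 + d * h * p ^ r] (mod p ^ (r + 1))"
    proof -
      have "[f = e ^ nat d] (mod p ^ (r + 1))"
        using f by (rule cong_dvd_modulus) (use rk in \<open>simp add: le_imp_power_dvd del: power_Suc\<close>)
      also have "[e ^ nat d = 1 + (e - 1) * d] (mod p ^ (r + 1))"
        using sq[of "r + 1" "nat d"] j d by simp
      also have "[1 + (e - 1) * d = 1 + (1 + h * p ^ r - 1) * d] (mod p ^ (r + 1))"
        by (intro cong_add cong_mult cong_diff e1 cong_refl)
      finally show ?thesis by (simp add: mult_ac)
    qed
    then have "[c * f = c * (1 + d * h * p ^ r)] (mod p ^ (r + 1))" by (rule cong_scalar_left)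
    then have "[b - c * f = b - c * (1 + d * h * p ^ r)] (mod p ^ (r + 1))"
      by (intro cong_diff cong_refl)
    also have "b - c * (1 + d * h * p ^ r) = p ^ r * (t - c * d * h)"
      using t by (simp add: algebra_simps)
    finally have A: "[b - c * f = p ^ r * (t - c * d * h)] (mod p ^ (r + 1))" .
    have "p dvd p ^ r" using j by (simp add: dvd_power)
    then have "p dvd b - c" using i dvd_trans by blast
    then have cb: "[c = b] (mod p)" by (simp add: cong_iff_dvd_diff dvd_diff_commute)
    have "[c * d * h = b * (g * t) * h] (mod p)"
      by (intro cong_mult cb cong_refl) (simp add: d_def t_def)
    also have "b * (g * t) * h = (g * (h * b)) * t" by (simp add: mult_ac)
    also have "[(g * (h * b)) * t = 1 * t] (mod p)" using j(3) by (rule cong_scalar_right)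
    finally have "p dvd t - c * d * h" by (simp add: cong_iff_dvd_diff dvd_diff_commute)
    then have "p ^ (r + 1) dvd p ^ r * (t - c * d * h)" by simp
    then show ?thesis using A by (simp add: cong_dvd_iff del: power_Suc)
  qed
  have "p ^ (r + 1) dvd p ^ k" using rk by (simp add: le_imp_power_dvd del: power_Suc)
  then have "[(c * f) mod p ^ k = c * f] (mod p ^ (r + 1))"
    by (rule cong_dvd_modulus[rotated]) simp
  then have "[b - (c * f) mod p ^ k = b - c * f] (mod p ^ (r + 1))"
    by (intro cong_diff cong_refl)
  then have dvd': "p ^ (r + 1) dvd b - (c * f) mod p ^ k" using dvd by (simp only: cong_dvd_iff)
  \<comment> \<open>\<open>e'\<close> is known only modulo \<open>p ^ k\<close>, so
    \<open>p ^ (r + 2)\<close> has to divide that modulus.\<close>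
  have lift: "[e' = 1 + h * p ^ (r + 1)] (mod p ^ (r + 1 + 1))" if "r + 1 < k"
  proof -
    have "[e' = e ^ nat p] (mod p ^ (r + 2))"
      using e' by (rule cong_dvd_modulus) (use that in \<open>simp add: le_imp_power_dvd del: power_Suc\<close>)
    from cong_trans[OF this prime_power_lift_cong[OF p j(1,2) e1]] show ?thesis by simp
  qed
  show ?thesis
    unfolding body using p0 i j d rk c' e'' dvd' lift
    by (simp add: dll_invariant_def s mult.commute)
qed

lemma dll_main_loop_result:
  assumes "prime p" "0 \<le> z" "0 \<le> b" "b < p ^ k" "dll_invariant a z b p k h g s"
  obtains t where "dll_main_loop p k (p ^ k) b g s = Some t" "0 \<le> st_y t"
    "[a ^ nat ((p - 1) * st_y t + z) = b] (mod p ^ k)"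
proof -
  obtain t where "dll_main_loop p k (p ^ k) b g s = Some t" "dll_invariant a z b p k h g t"
      "b = st_c t"
    unfolding dll_main_loop_def
    by (rule measure_while_option_invariant[where P = "dll_invariant a z b p k h g"
        and f = "\<lambda>s. k - st_r s" and s = s and b = "\<lambda>s. b \<noteq> st_c s" and c = "dll_main_body p k (p ^ k) b g"])
      (use dll_invariant_main_body assms in auto)
  then show thesis using that by (auto simp: dll_invariant_def cong_sym_eq)
qed

section \<open>The complete run: soundness of the answer None, and the invariant on entry to the
  main loop\<close>

theorem theorem1:
  fixes p a b z :: int and k :: nat
  assumes "prime p"
    and "z \<ge> 0"
    and "\<not> p dvd a"
    and "[a ^ nat z = b] (mod p)"
  shows "(\<exists>out. DLL a z b p k = Some out \<and>
            ((\<exists>x. out = Output x \<and> x \<ge> 0 \<and> [a ^ nat x = b] (mod p ^ k)) \<or> out = Output_None))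
       \<and> (DLL a z b p k = Some Output_None \<longrightarrow>
            \<not> (\<exists>x::int. x \<ge> 0 \<and> [a ^ nat x = b] (mod p ^ k)))"
proof -
  note p = assms(1) and pa = assms(3)
  have p0: "p > 1" using p by (simp add: prime_gt_1_int)
  define m where "m = p ^ k"
  define z' where "z' = z mod (p - 1)"
  define A where "A = a mod m"
  define B where "B = b mod m"
  define c0 where "c0 = A ^ nat z' mod m"
  define u :: int where "u = (if p = 2 then 2 else 1)"
  define e where "e = (if p = 2 then A ^ 2 mod m else A ^ nat (p - 1) mod m)"
  have m0: "m > 0" using p0 by (simp add: m_def)
  have z': "z' \<ge> 0" "p = 2 \<Longrightarrow> z' = 0" using p0 by (auto simp: z'_def)
  have B: "0 \<le> B" "B < m" "[B = b] (mod m)" using m0 by (auto simp: B_def)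
  have A: "0 \<le> A" "A < m" "[A = a] (mod m)" using m0 by (auto simp: A_def)
  have c0: "0 \<le> c0" "c0 < m" "[c0 = a ^ nat z'] (mod m)"
    using m0 cong_pow[OF A(3)] by (auto simp: c0_def)
  have e: "[e = a ^ nat ((p - 1) * u)] (mod m)"
    using cong_pow[OF A(3)] by (auto simp: e_def u_def)
  obtain h r where loop: "dll_valuation_loop p k e = Some (h, r)" and hr: "h * p ^ r = e - 1"
      and rk: "r \<le> k" and ph: "r < k \<longrightarrow> \<not> p dvd h"
    using dll_valuation_loop_result[OF p0] by blast
  have rm: "p ^ r dvd m" using rk by (simp add: m_def le_imp_power_dvd)
  have er: "[a ^ nat ((p - 1) * u) = 1] (mod p ^ r)"
  proof -
    have "[e = 1] (mod p ^ r)" by (simp add: cong_iff_dvd_diff flip: hr)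
    then show ?thesis using cong_dvd_modulus[OF e rm] cong_trans cong_sym by blast
  qed
  have bz: "[a ^ nat z' = b] (mod p)"
    unfolding z'_def using power_cong_power_mod_prime_minus_1[OF p pa assms(2)] assms(4)
    by (meson cong_sym cong_trans)
  define v where "v = p ^ r"
  have DLL_eq: "DLL a z b p k =
     (if \<not> v dvd B - c0 \<and> (p > 2 \<or> \<not> v dvd B - A) then Some Output_None
      else case dll_main_loop p k m B ((h * B) ^ nat (p - 2) mod p)
                  \<lparr> st_c = if v dvd B - c0 then c0 else A, st_y = if v dvd B - c0 then 0 else 1,
                    st_e = e, st_u = u, st_v = v, st_r = r \<rparr> of
             None \<Rightarrow> None
           | Some s \<Rightarrow> Some (Output ((p - 1) * st_y s + z')))"
    unfolding DLL_def Let_def m_def[symmetric] z'_def[symmetric] A_def[symmetric] B_def[symmetric]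
    unfolding c0_def[symmetric] u_def[symmetric] e_def[symmetric]
    unfolding loop option.case prod.case v_def[symmetric] ..
  \<comment> \<open>For \<open>p = 2\<close> the parity of \<open>x\<close> decides: even powers of
    \<open>a\<close> are 1, which is \<open>c0\<close> because \<open>z' = 0\<close>, and odd powers
    are \<open>a\<close>. For odd \<open>p\<close>, \<open>a ^ x\<close> and
    \<open>a ^ nat z'\<close> agree modulo \<open>p\<close>, hence modulo \<open>v\<close>.\<close>
  have no_solution: "v dvd B - c0 \<or> (p = 2 \<and> v dvd B - A)" if "[a ^ x = b] (mod m)" for x
  proof (cases "p = 2")
    case True
    have sq: "[a\<^sup>2 = 1] (mod v)" using er True by (simp add: u_def v_def)
    have Bx: "[B = a ^ x] (mod v)"
      by (rule cong_dvd_modulus[of _ _ m]) (use B(3) that rm in \<open>auto simp: v_def cong_sym_eq intro: cong_trans\<close>)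
    have ev: "[a ^ (2 * n) = 1] (mod v)" for n using cong_pow[OF sq, of n] by (simp add: power_mult)
    show ?thesis
    proof (cases "even x")
      case True
      then have "[a ^ x = 1] (mod v)" using ev by (auto elim: evenE)
      moreover have "[c0 = 1] (mod v)"
        using cong_dvd_modulus[OF c0(3) rm] z' \<open>p = 2\<close> by (simp add: v_def)
      ultimately have "[B = c0] (mod v)" using Bx by (meson cong_sym cong_trans)
      then show ?thesis by (simp add: cong_iff_dvd_diff)
    next
      case False
      then obtain n where "x = 2 * n + 1" by (auto elim: oddE)
      then have "[a ^ x = a] (mod v)" using cong_scalar_left[OF ev[of n], of a] by simp
      moreover have "[A = a] (mod v)"
        using cong_dvd_modulus[OF A(3) rm] by (simp add: v_def)
      ultimately have "[B = A] (mod v)" using Bx by (meson cong_sym cong_trans)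
      then show ?thesis using True by (simp add: cong_iff_dvd_diff)
    qed
  next
    case False
    have "[a ^ x = a ^ nat z'] (mod v)"
    \<comment> \<open>For \<open>k = 0\<close> a solution modulo \<open>m = 1\<close> says nothing
      modulo \<open>p\<close>, but then \<open>v = 1\<close>.\<close>
    proof (cases "k = 0")
      case True
      then show ?thesis using rk by (simp add: v_def)
    next
      case False
      then have "[a ^ x = b] (mod p)" using that cong_dvd_modulus[of _ _ m p] by (simp add: m_def)
      then have "[a ^ x = a ^ nat z'] (mod p)" using bz by (meson cong_sym cong_trans)
      then show ?thesis
        unfolding v_def using er \<open>p \<noteq> 2\<close>
        by (intro power_cong_prime_imp_prime_power p pa) (simp_all add: u_def)
    qed
    moreover have "[B = a ^ x] (mod v)"
      by (rule cong_dvd_modulus[of _ _ m]) (use B(3) that rm in \<open>auto simp: v_def cong_sym_eq intro: cong_trans\<close>)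
    moreover have "[c0 = a ^ nat z'] (mod v)"
      using cong_dvd_modulus[OF c0(3) rm] by (simp add: v_def)
    ultimately have "[B = c0] (mod v)" by (meson cong_sym cong_trans)
    then show ?thesis by (simp add: cong_iff_dvd_diff)
  qed
  show ?thesis
  proof (cases "\<not> v dvd B - c0 \<and> (p > 2 \<or> \<not> v dvd B - A)")
    case True
    then have "DLL a z b p k = Some Output_None"
      unfolding DLL_eq by simp
    moreover have "\<not> (\<exists>x. x \<ge> 0 \<and> [a ^ nat x = b] (mod p ^ k))"
      using no_solution True by (auto simp: m_def)
    ultimately show ?thesis by simp
  next
    case False
    define c where "c = (if v dvd B - c0 then c0 else A)"
    define y :: int where "y = (if v dvd B - c0 then 0 else 1)"
    define g where "g = (h * B) ^ nat (p - 2) mod p"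
    have p2: "p = 2" if "\<not> v dvd B - c0" using False that p0 by auto
    have strict: "1 \<le> r \<and> (p = 2 \<longrightarrow> 2 \<le> r) \<and> [g * (h * B) = 1] (mod p)" if "r < k"
    proof -
      \<comment> \<open>For \<open>r < k\<close> the valuation loop stopped at an \<open>h\<close>
        prime to \<open>p\<close>, so \<open>p ^ r\<close> is the exact power of \<open>p\<close> in
        \<open>e - 1\<close>; as \<open>r + 1 \<le> k\<close>, this passes to the power of
        \<open>a\<close>.\<close>
      have nd: "\<not> p ^ (r + 1) dvd a ^ nat ((p - 1) * u) - 1"
      proof
        assume "p ^ (r + 1) dvd a ^ nat ((p - 1) * u) - 1"
        moreover have "[e = a ^ nat ((p - 1) * u)] (mod p ^ (r + 1))"
          using e by (rule cong_dvd_modulus) (use that in \<open>simp add: m_def le_imp_power_dvd del: power_Suc\<close>)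
        ultimately have "p ^ (r + 1) dvd e - 1"
          by (metis cong_dvd_iff cong_diff cong_refl)
        then have "p dvd h" using p0 by (simp flip: hr)
        then show False using ph that by simp
      qed
      have pm: "p dvd m" using that by (simp add: m_def)
      \<comment> \<open>By Fermat's theorem \<open>p\<close> divides the difference in
        \<open>nd\<close>, which excludes \<open>r = 0\<close>.\<close>
      have "1 \<le> r"
      proof (rule ccontr)
        assume "\<not> 1 \<le> r"
        moreover have "[a ^ nat ((p - 1) * u) = 1] (mod p)"
          using cong_pow[OF fermat_theorem_int[OF p pa], of "nat u"] p0
          by (simp add: power_mult[symmetric] nat_mult_distrib)
        ultimately show False using nd by (simp add: cong_iff_dvd_diff not_le)
      qed
      \<comment> \<open>This is the gain from starting with \<open>a ^ 2\<close>: for odd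
        \<open>a\<close> both \<open>a - 1\<close> and \<open>a + 1\<close> are even, so 4 divides
        \<open>a ^ 2 - 1\<close>.\<close>
      moreover have "2 \<le> r" if "p = 2"
      proof (rule ccontr)
        assume "\<not> 2 \<le> r"
        then have "p ^ (r + 1) dvd p ^ 2" by (intro le_imp_power_dvd) simp
        also have "p ^ 2 dvd a ^ 2 - 1"
        proof -
          have "2 * 2 dvd (a - 1) * (a + 1)"
            by (rule mult_dvd_mono) (use pa that in auto)
          then show ?thesis using that by (simp add: algebra_simps power2_eq_square)
        qed
        finally show False using nd that by (simp add: u_def)
      qed
      moreover have "[g * (h * B) = 1] (mod p)"
      proof -
        have "[B = a ^ nat z'] (mod p)"
          using cong_dvd_modulus[OF B(3) pm] bz by (meson cong_sym cong_trans)
        then have "\<not> p dvd B" using pa p by (simp add: cong_dvd_iff prime_dvd_power_iff) (metis prime_dvd_power)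
        then have "\<not> p dvd h * B" using ph that p by (simp add: prime_dvd_mult_iff)
        note F = fermat_theorem_int[OF p this]
        have "[g * (h * B) = (h * B) ^ nat (p - 2) * (h * B)] (mod p)"
          unfolding g_def by (intro cong_mult cong_refl) simp
        also have "(h * B) ^ nat (p - 2) * (h * B) = (h * B) ^ Suc (nat (p - 2))" by simp
        also have "Suc (nat (p - 2)) = nat (p - 1)" using p0 by linarith
        finally show ?thesis using F cong_trans by blast
      qed
      ultimately show ?thesis by blast
    qed
    \<comment> \<open>In the fallback case \<open>p = 2\<close>, \<open>z' = 0\<close> and
      \<open>y = 1\<close>, so the exponent is 1, matching \<open>c = A\<close>.\<close>
    have "[c = a ^ nat ((p - 1) * y + z')] (mod m)"
      using c0(3) A(3) z' p2 by (auto simp: c_def y_def)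
    moreover have "e = 1 + h * p ^ r" using hr by simp
    moreover have "v dvd B - c" using False p2 by (auto simp: c_def)
    moreover have "0 \<le> c" "c < m" "0 \<le> y" "0 \<le> u" using c0 A by (auto simp: c_def y_def u_def)
    ultimately have "dll_invariant a z' B p k h g
        \<lparr>st_c = c, st_y = y, st_e = e, st_u = u, st_v = v, st_r = r\<rparr>"
      using e strict rk by (auto simp: dll_invariant_def m_def v_def)
    from dll_main_loop_result[OF p z'(1) B(1) B(2)[unfolded m_def] this]
    obtain t where t: "dll_main_loop p k m B g
          \<lparr>st_c = c, st_y = y, st_e = e, st_u = u, st_v = v, st_r = r\<rparr> = Some t"
        "0 \<le> st_y t" "[a ^ nat ((p - 1) * st_y t + z') = B] (mod m)"
      by (auto simp: m_def)
    have "DLL a z b p k = Some (Output ((p - 1) * st_y t + z'))"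
      unfolding DLL_eq using False t(1) by (auto simp: c_def y_def g_def)
    moreover have "(p - 1) * st_y t + z' \<ge> 0" using p0 t(2) z' by simp
    moreover have "[a ^ nat ((p - 1) * st_y t + z') = b] (mod p ^ k)"
      using t(3) B(3) cong_trans unfolding m_def by blast
    ultimately show ?thesis by simp
  qed
qed

end
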